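(* Let $n\ge 2$ and $\mu\in[0,1)$. Let $H$ be the Hamiltonian of the circular restricted three body problem with mass ratio $\mu$ in rotating coordinates, let $B$ be the Birkhoff involution, let $\iota\circ\varphi\colon T^*\mathbb{R}^n\to T^*S^n$ be the Moser regularization embedding, let $\rho\colon S^n\to S^n$ be the reflection $(p_1,p_2,\ldots,p_{n+1})\mapsto(-p_1,p_2,\ldots,p_{n+1})$, and let $\pi\colon T^*S^n\to S^n$ be the footpoint projection (all as defined in the context). After Moser regularization the $O(2)$-action on periodic trajectories of the circular restricted three body problem (rotation of the domain for $SO(2)$, and time reversal combined with the Birkhoff involution for the reflection) coincides with the twisted $O(2)$-action on the free loop space $\mathscr{L}=C^\infty(S^1,S^n)$. Precisely: the Birkhoff involution $B$, under which $H$ is invariant, extends to the antisymplectic involution $\overline{B}=I\circ d^*\rho$ of $T^*S^n$, i.e. $\overline{B}\circ\iota\circ\varphi=\iota\circ\varphi\circ B$ on $T^*\mathbb{R}^n$; and for the resulting $O(2)$-action on loops $w\in C^\infty(S^1,T^*S^n)$ (hence on periodic trajectories of the regularized problem), given by $(g_*w)(t)=\overline{B}^{\,\epsilon(g)}\big(w(gt)\big)$, one has for all $g\in O(2)$ $$\pi\circ (g_*w)=g_*(\pi\circ w),$$ where on the right-hand side $g_*$ denotes the twisted $O(2)$-action on $\mathscr{L}$.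
   Context: **Loops and the twisted action.** $O(2)$ acts on the circle $S^1$ in the standard way. For $g\in O(2)$ put $\epsilon(g)=\frac{1-\det g}{2}\in\{0,1\}$, so $\epsilon(g)=0$ if $g\in SO(2)$ and $\epsilon(g)=1$ otherwise. Here $S^n=\{p\in\mathbb{R}^{n+1}:\|p\|=1\}$. The twisted $O(2)$-action on $\mathscr{L}=C^\infty(S^1,S^n)$ is $(g_*v)(t)=\rho^{\epsilon(g)}\big(v(gt)\big)$ for $v\in\mathscr{L}$, $t\in S^1$. (With these formulas composition of the $g_*$ follows the usual convention for precomposition.) **The restricted three body problem.** Let $e_1,\ldots,e_n$ be the standard basis of $\mathbb{R}^n$, $E=\mu e_1$ (earth, mass $1-\mu$) and $M=-(1-\mu)e_1$ (moon, mass $\mu$). The Hamiltonian $H\colon T^*(\mathbb{R}^n\setminus\{E,M\})\to\mathbb{R}$ is $$H(q,p)=\tfrac12|p|^2-\frac{1-\mu}{|q-E|}-\frac{\mu}{|q-M|}+p_1q_2-p_2q_1,$$ and the symplectic form is $\omega=\sum_i dq_i\wedge dp_i$. **Birkhoff involution.** Write vectors of $\mathbb{R}^n$ as $q=(q_1,q_2,q^3)$ with $q^3\in\mathbb{R}^{n-2}$. The Birkhoff involution is the antisymplectic involution $B\colon T^*\mathbb{R}^n\to T^*\mathbb{R}^n$, $$B(q_1,q_2,q^3,p_1,p_2,p^3)=(q_1,-q_2,-q^3,-p_1,p_2,p^3).$$ For a trajectory $w$ of the Hamiltonian flow of $H$, $Rw(t)=B(w(-t))$ is again a trajectory. The $O(2)$-action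 on periodic trajectories is given, with $O(2)=SO(2)\rtimes\mathbb{Z}_2$, by rotation of the domain for $SO(2)$ and by $w\mapsto Rw$ for the generator of $\mathbb{Z}_2$. **Moser regularization.** $\varphi\colon T^*\mathbb{R}^n\to T^*\mathbb{R}^n$ is the symplectomorphism $\varphi(q,p)=(-p,q-E)$ (the first entry of the image is the base coordinate, the second the fiber coordinate). $\iota\colon T^*\mathbb{R}^n\to T^*S^n$ is the inclusion obtained by viewing $\mathbb{R}^n$ as the chart of $S^n$ under stereographic projection: $\iota(x,y)=\big(\sigma(x),\,y\circ (d\sigma_x)^{-1}\big)$, where $\sigma\colon\mathbb{R}^n\to S^n\setminus\{(0,\ldots,0,1)\}$ is the inverse of stereographic projection from the pole $(0,\ldots,0,1)$. The Moser regularization of a subset $\Sigma$ of an energy hypersurface of $H$ around the earth is the closure of $\iota\varphi(\Sigma)$ in $T^*S^n$. **Involutions of $T^*S^n$.** $d^*\rho\colon T^*S^n\to T^*S^n$ is the symplectic involution induced by $\rho$, i.e. $d^*\rho(x,\eta)=(\rho(x),\eta\circ d\rho_{\rho(x)})$. $I\colon T^*S^n\to T^*S^n$ is the antisymplectic involution equal to $-\mathrm{id}$ on each fiber $T_x^*S^n$. *)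

theory Defs
  imports "HOL-Analysis.Analysis"
begin

(*
  R^n is real^'n with n = CARD('n), and R^(n+1) is (real^'n) \<times> real, the last coordinate p_(n+1)
  being the second component.  The product norm is the Euclidean one.  A numbering
  ix :: nat => 'n, a bijection from {1..n}, says which component is the i-th one; thus
  e_i is axis (ix i) 1 and q_i is q $ ix i.
*)

type_synonym 'n phase = "(real^'n) \<times> (real^'n)"
type_synonym 'n ambient = "(real^'n) \<times> real"
type_synonym 'n covec = "'n ambient \<times> ('n ambient \<Rightarrow>\<^sub>L real)"

section \<open>Loops and O(2)\<close>

abbreviation S1 :: "(real^2) set" where
  "S1 \<equiv> sphere 0 1"

definition circ :: "real \<Rightarrow> real^2" where
  "circ s = vector [cos s, sin s]"

definition smooth_curve :: "(real \<Rightarrow> 'a::real_normed_vector) \<Rightarrow> bool" where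
  "smooth_curve f \<longleftrightarrow>
     (\<exists>D :: nat \<Rightarrow> real \<Rightarrow> 'a. D 0 = f \<and>
        (\<forall>k s. (D k has_vector_derivative D (Suc k) s) (at s)))"

(*
  Smooth loops with values in a subset M of a normed space.  If M is an embedded submanifold
  this is C^infinity(S^1, M), since s |-> circ s is a local diffeomorphism onto S^1.  Only the
  values on S1 matter; loops are compared on S1.
*)
definition smooth_loops :: "'a::real_normed_vector set \<Rightarrow> (real^2 \<Rightarrow> 'a) set" where
  "smooth_loops M = {v. (\<forall>t\<in>S1. v t \<in> M) \<and> smooth_curve (\<lambda>s. v (circ s))}"

definition O2 :: "(real^2^2) set" where
  "O2 = {g. orthogonal_matrix g}"

definition eps :: "real^2^2 \<Rightarrow> nat" where
  "eps g = nat \<lfloor>(1 - det g) / 2\<rfloor>"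

definition loop_act :: "('a \<Rightarrow> 'a) \<Rightarrow> real^2^2 \<Rightarrow> (real^2 \<Rightarrow> 'a) \<Rightarrow> (real^2 \<Rightarrow> 'a)" where
  "loop_act F g w = (\<lambda>t. (F ^^ eps g) (w (g *v t)))"

(* Precomposition is contravariant: (g h)_* = h_* g_*. *)
definition is_O2_action :: "(real^2 \<Rightarrow> 'a) set \<Rightarrow> (real^2^2 \<Rightarrow> (real^2 \<Rightarrow> 'a) \<Rightarrow> (real^2 \<Rightarrow> 'a)) \<Rightarrow> bool" where
  "is_O2_action L act \<longleftrightarrow>
     (\<forall>g\<in>O2. \<forall>w\<in>L. act g w \<in> L) \<and>
     (\<forall>w\<in>L. \<forall>t\<in>S1. act (mat 1) w t = w t) \<and>
     (\<forall>g\<in>O2. \<forall>h\<in>O2. \<forall>w\<in>L. \<forall>t\<in>S1. act (g ** h) w t = act h (act g w) t)"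

section \<open>The sphere and its cotangent bundle\<close>

definition Sn :: "'n::finite ambient set" where
  "Sn = sphere 0 1"

definition pole :: "'n::finite ambient" where
  "pole = (0, 1)"

definition rho :: "(nat \<Rightarrow> 'n::finite) \<Rightarrow> 'n ambient \<Rightarrow> 'n ambient" where
  "rho ix = (\<lambda>(p, s). (\<chi> i. if i = ix 1 then - p $ i else p $ i, s))"

(*
  A covector on T_x S^n (the orthogonal complement of x) is stored as the functional on R^(n+1)
  extending it by 0 on the normal line spanned by x.  This realises T^*S^n as an embedded
  submanifold of the vector space R^(n+1) \<times> (R^(n+1))^*, from which it takes its topology and
  its smooth structure.  The footpoint projection is fst.
*)
definition TstarS :: "'n::finite covec set" where
  "TstarS = {(x, \<eta>). x \<in> Sn \<and> blinfun_apply \<eta> x = 0}"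

definition ext_covector :: "'n::finite ambient \<Rightarrow> ('n ambient \<Rightarrow> real) \<Rightarrow> ('n ambient \<Rightarrow>\<^sub>L real)" where
  "ext_covector x f = Blinfun (\<lambda>v. f (v - (v \<bullet> x) *\<^sub>R x))"

(*
  The canonical form on T^*R^(n+1), in the sign convention dq \<and> dp.  The Liouville form
  eta(dx) of T^*R^(n+1) restricts to that of T^*S^n under the embedding above, hence so
  does this form.
*)
definition omega_S :: "'n::finite covec \<Rightarrow> 'n covec \<Rightarrow> real" where
  "omega_S = (\<lambda>(\<xi>, \<zeta>) (\<xi>', \<zeta>'). blinfun_apply \<zeta>' \<xi> - blinfun_apply \<zeta> \<xi>')"

definition tangent_vectors :: "'a::real_normed_vector set \<Rightarrow> 'a \<Rightarrow> 'a set" where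
  "tangent_vectors M z =
     {v. \<exists>\<gamma> :: real \<Rightarrow> 'a. \<gamma> 0 = z \<and> (\<forall>t. \<gamma> t \<in> M) \<and> (\<gamma> has_vector_derivative v) (at 0)}"

definition antisymplectic_involution ::
    "'a::real_normed_vector set \<Rightarrow> ('a \<Rightarrow> 'a \<Rightarrow> real) \<Rightarrow> ('a \<Rightarrow> 'a) \<Rightarrow> bool" where
  "antisymplectic_involution M om F \<longleftrightarrow>
     (\<forall>z\<in>M. F z \<in> M \<and> F (F z) = z) \<and>
     (\<forall>z\<in>M. \<exists>D. (F has_derivative D) (at z within M) \<and>
        (\<forall>u\<in>tangent_vectors M z. \<forall>v\<in>tangent_vectors M z. om (D u) (D v) = - om u v))"

definition dstar_rho :: "(nat \<Rightarrow> 'n::finite) \<Rightarrow> 'n covec \<Rightarrow> 'n covec" where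
  "dstar_rho ix = (\<lambda>(x, \<eta>).
     (rho ix x,
      ext_covector (rho ix x)
        (blinfun_apply \<eta> \<circ> frechet_derivative (rho ix) (at (rho ix x)))))"

definition fiber_neg :: "'n::finite covec \<Rightarrow> 'n covec" where
  "fiber_neg = (\<lambda>(x, \<eta>). (x, - \<eta>))"

definition Bbar :: "(nat \<Rightarrow> 'n::finite) \<Rightarrow> 'n covec \<Rightarrow> 'n covec" where
  "Bbar ix = fiber_neg \<circ> dstar_rho ix"

section \<open>The restricted three body problem\<close>

definition earth :: "(nat \<Rightarrow> 'n::finite) \<Rightarrow> real \<Rightarrow> real^'n" where
  "earth ix \<mu> = \<mu> *\<^sub>R axis (ix 1) 1"

definition moon :: "(nat \<Rightarrow> 'n::finite) \<Rightarrow> real \<Rightarrow> real^'n" where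
  "moon ix \<mu> = - (1 - \<mu>) *\<^sub>R axis (ix 1) 1"

definition phase_space :: "(nat \<Rightarrow> 'n::finite) \<Rightarrow> real \<Rightarrow> 'n phase set" where
  "phase_space ix \<mu> = (UNIV - {earth ix \<mu>, moon ix \<mu>}) \<times> UNIV"

definition Ham :: "(nat \<Rightarrow> 'n::finite) \<Rightarrow> real \<Rightarrow> 'n phase \<Rightarrow> real" where
  "Ham ix \<mu> = (\<lambda>(q, p).
     (norm p)\<^sup>2 / 2 - (1 - \<mu>) / norm (q - earth ix \<mu>) - \<mu> / norm (q - moon ix \<mu>)
       + p $ ix 1 * q $ ix 2 - p $ ix 2 * q $ ix 1)"

definition birkhoff :: "(nat \<Rightarrow> 'n::finite) \<Rightarrow> 'n phase \<Rightarrow> 'n phase" where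
  "birkhoff ix = (\<lambda>(q, p).
     (\<chi> i. if i = ix 1 then q $ i else - q $ i,
      \<chi> i. if i = ix 1 then - p $ i else p $ i))"

definition omega_R :: "'n::finite phase \<Rightarrow> 'n phase \<Rightarrow> real" where
  "omega_R = (\<lambda>(\<xi>, \<zeta>) (\<xi>', \<zeta>'). \<xi> \<bullet> \<zeta>' - \<xi>' \<bullet> \<zeta>)"

(*
  X is the Hamiltonian vector field of H at z.  The sign, omega(X, .) = dH, gives
  q' = dH/dp and p' = - dH/dq.
*)
definition ham_vector :: "(nat \<Rightarrow> 'n::finite) \<Rightarrow> real \<Rightarrow> 'n phase \<Rightarrow> 'n phase \<Rightarrow> bool" where
  "ham_vector ix \<mu> z X \<longleftrightarrow>
     (\<exists>dH. (Ham ix \<mu> has_derivative dH) (at z) \<and> (\<forall>u. omega_R X u = dH u))"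

definition trajectory :: "(nat \<Rightarrow> 'n::finite) \<Rightarrow> real \<Rightarrow> (real \<Rightarrow> 'n phase) \<Rightarrow> bool" where
  "trajectory ix \<mu> w \<longleftrightarrow>
     (\<forall>t. w t \<in> phase_space ix \<mu> \<and>
        (\<exists>X. ham_vector ix \<mu> (w t) X \<and> (w has_vector_derivative X) (at t)))"

(* The trajectories of period tau, reparametrised by S^1 = R / tau Z. *)
definition periodic_trajectories :: "(nat \<Rightarrow> 'n::finite) \<Rightarrow> real \<Rightarrow> real \<Rightarrow> (real^2 \<Rightarrow> 'n phase) set" where
  "periodic_trajectories ix \<mu> \<tau> =
     {v. v \<in> smooth_loops (phase_space ix \<mu>) \<and> trajectory ix \<mu> (\<lambda>t. v (circ (2 * pi * t / \<tau>)))}"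

section \<open>Moser regularization\<close>

definition phi_map :: "(nat \<Rightarrow> 'n::finite) \<Rightarrow> real \<Rightarrow> 'n phase \<Rightarrow> 'n phase" where
  "phi_map ix \<mu> = (\<lambda>(q, p). (- p, q - earth ix \<mu>))"

(* Projection from the pole to the equatorial hyperplane p_(n+1) = 0. *)
definition stereo :: "'n::finite ambient \<Rightarrow> real^'n" where
  "stereo = (\<lambda>(p, s). p /\<^sub>R (1 - s))"

definition stereo_inv :: "real^'n::finite \<Rightarrow> 'n ambient" where
  "stereo_inv = inv_into (Sn - {pole}) stereo"

(*
  The derivative of stereo_inv at x is injective with range the tangent space of S^n at
  stereo_inv x, the only place where ext_covector evaluates its argument.
*)
definition iota_map :: "'n::finite phase \<Rightarrow> 'n covec" where
  "iota_map = (\<lambda>(x, y).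
     (stereo_inv x,
      ext_covector (stereo_inv x)
        ((\<lambda>u. y \<bullet> u) \<circ> inv (frechet_derivative stereo_inv (at x)))))"

definition energy_surface :: "(nat \<Rightarrow> 'n::finite) \<Rightarrow> real \<Rightarrow> real \<Rightarrow> 'n phase set" where
  "energy_surface ix \<mu> c = {z \<in> phase_space ix \<mu>. Ham ix \<mu> z = c}"

definition moser_reg :: "(nat \<Rightarrow> 'n::finite) \<Rightarrow> real \<Rightarrow> 'n phase set \<Rightarrow> 'n covec set" where
  "moser_reg ix \<mu> S = closure ((iota_map \<circ> phi_map ix \<mu>) ` S) \<inter> TstarS"

(*
  Periodic trajectories of the regularized problem on the Moser regularization of S: immersed
  smooth loops which, away from the collision fiber over the pole, are the image of a
  trajectory of H up to a positive change of time (the regularized flow is a time change of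
  the original one), and which meet the collision fiber in a set of times without interior.
*)
definition regularized_trajectories ::
    "(nat \<Rightarrow> 'n::finite) \<Rightarrow> real \<Rightarrow> 'n phase set \<Rightarrow> (real^2 \<Rightarrow> 'n covec) set" where
  "regularized_trajectories ix \<mu> S =
     {w. w \<in> smooth_loops (moser_reg ix \<mu> S) \<and>
         (\<forall>s. vector_derivative (\<lambda>r. w (circ r)) (at s) \<noteq> 0) \<and>
         closure {s. fst (w (circ s)) \<noteq> pole} = UNIV \<and>
         (\<forall>s. fst (w (circ s)) \<noteq> pole \<longrightarrow>
            (\<exists>z a X. (\<forall>\<^sub>F r in nhds s. (iota_map \<circ> phi_map ix \<mu>) (z r) = w (circ r)) \<and>
               z s \<in> phase_space ix \<mu> \<and> a > 0 \<and> ham_vector ix \<mu> (z s) X \<and>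
               (z has_vector_derivative a *\<^sub>R X) (at s)))}"

end

theory Submission
  imports Defs
begin

text \<open>The Moser embedding has the closed form
  \<open>(x, y) \<mapsto> (\<sigma> x, \<langle>((|x|\<^sup>2 + 1)/2 y - (x\<bullet>y) x, x\<bullet>y), _\<rangle>)\<close>. If \<open>r\<close> flips the first coordinate of
  \<open>\<real>\<^sup>n\<close>, the Birkhoff involution is \<open>(q, p) \<mapsto> (- r q, r p)\<close>, which \<open>\<phi>\<close> turns into
  \<open>(x, y) \<mapsto> (r x, - r y)\<close> since \<open>r E = - E\<close>; the closed form turns this in turn into
  \<open>(p, \<eta>) \<mapsto> (\<rho> p, - \<eta> \<circ> \<rho>)\<close>. All involutions involved are restrictions of linear maps, and an
  element of \<open>O(2)\<close> acts on angles by \<open>s \<mapsto> \<plusminus>s + a\<close> with the sign of its determinant, so that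
  invariance of each class of loops reduces to an affine change of time composed with a linear
  map.\<close>

section \<open>Smooth curves\<close>

text \<open>Differentiability to finite order, by recursion. \<open>smooth_curve\<close> asks for
  one sequence of all derivatives, which would force Leibniz-type formulas; here closure under
  products or inverses follows by induction on the order.\<close>

primrec k_smooth :: "nat \<Rightarrow> (real \<Rightarrow> 'a::real_normed_vector) \<Rightarrow> bool" where
  "k_smooth 0 f \<longleftrightarrow> True"
| "k_smooth (Suc k) f \<longleftrightarrow> (\<exists>f'. (\<forall>s. (f has_vector_derivative f' s) (at s)) \<and> k_smooth k f')"

lemma k_smooth_Suc_D: "k_smooth (Suc k) f \<Longrightarrow> k_smooth k f"
  by (induction k arbitrary: f) (simp, metis k_smooth.simps(2))

text \<open>The witnesses for different orders are a priori unrelated; uniqueness of the vector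
  derivative glues them into a single sequence.\<close>

lemma smooth_curve_iff_k_smooth: "smooth_curve f \<longleftrightarrow> (\<forall>k. k_smooth k f)"
proof
  assume "smooth_curve f"
  then obtain D where D: "D 0 = f" "\<And>k s. (D k has_vector_derivative D (Suc k) s) (at s)"
    by (auto simp: smooth_curve_def)
  have "k_smooth k (D j)" for k j
    by (induction k arbitrary: j) (use D(2) in auto)
  then show "\<forall>k. k_smooth k f"
    using D(1) by metis
next
  assume smooth: "\<forall>k. k_smooth k f"
  \<comment> \<open>Iterating \<open>vector_derivative\<close> makes the choice canonical; the next
    fact identifies every witness in \<open>k_smooth\<close> with it.\<close>
  define D where "D j = ((\<lambda>g s. vector_derivative g (at s)) ^^ j) f" for j
  have D_Suc: "D (Suc j) = (\<lambda>s. vector_derivative (D j) (at s))" for j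
    by (simp add: D_def)
  have *: "(\<forall>s. (g has_vector_derivative vector_derivative g (at s)) (at s))
      \<and> k_smooth k (\<lambda>s. vector_derivative g (at s))"
    if "k_smooth (Suc k) g" for k and g :: "real \<Rightarrow> 'a"
  proof -
    from that obtain g' where g': "\<And>s. (g has_vector_derivative g' s) (at s)" "k_smooth k g'"
      by auto
    then have "g' = (\<lambda>s. vector_derivative g (at s))"
      by (metis vector_derivative_at)
    with g' show ?thesis by simp
  qed
  have D_smooth: "k_smooth k (D j)" for k j
  proof (induction j arbitrary: k)
    case 0
    then show ?case using smooth by (simp add: D_def)
  next
    case (Suc j)
    then show ?case using *[of k "D j"] by (simp only: D_Suc)
  qed
  have "(D j has_vector_derivative D (Suc j) s) (at s)" for j s
    using *[OF D_smooth] by (auto simp: D_Suc)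
  moreover have "D 0 = f"
    by (simp add: D_def)
  ultimately show "smooth_curve f"
    unfolding smooth_curve_def by blast
qed

section \<open>Closure properties of finite-order differentiability\<close>

lemma k_smooth_const: "k_smooth k (\<lambda>s. c)"
  by (induction k arbitrary: c) (auto intro!: exI[of _ "\<lambda>s. 0"])

lemma k_smooth_add:
  "k_smooth k f \<Longrightarrow> k_smooth k g \<Longrightarrow> k_smooth k (\<lambda>s. f s + g s)"
proof (induction k arbitrary: f g)
  case (Suc k)
  then obtain f' g' where
    "\<And>s. (f has_vector_derivative f' s) (at s)" "k_smooth k f'"
    "\<And>s. (g has_vector_derivative g' s) (at s)" "k_smooth k g'"
    by auto
  then show ?case
    by (auto intro!: exI[of _ "\<lambda>s. f' s + g' s"] has_vector_derivative_add Suc.IH)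
qed simp

lemma k_smooth_linear:
  assumes "bounded_linear L"
  shows "k_smooth k f \<Longrightarrow> k_smooth k (\<lambda>s. L (f s))"
proof (induction k arbitrary: f)
  case (Suc k)
  then obtain f' where "\<And>s. (f has_vector_derivative f' s) (at s)" "k_smooth k f'"
    by auto
  then show ?case
    by (auto intro!: exI[of _ "\<lambda>s. L (f' s)"] Suc.IH bounded_linear.has_vector_derivative[OF assms])
qed simp

text \<open>Covers real, scalar and inner products at once. The derivative still contains the
  undifferentiated factors, so these are first lowered to order \<open>k\<close>.\<close>

lemma k_smooth_bilinear:
  assumes "bounded_bilinear b"
  shows "k_smooth k f \<Longrightarrow> k_smooth k g \<Longrightarrow> k_smooth k (\<lambda>s. b (f s) (g s))"
proof (induction k arbitrary: f g)
  case (Suc k)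
  then obtain f' g' where
    "\<And>s. (f has_vector_derivative f' s) (at s)" "k_smooth k f'"
    "\<And>s. (g has_vector_derivative g' s) (at s)" "k_smooth k g'"
    by auto
  moreover have "k_smooth k f" "k_smooth k g"
    using Suc.prems k_smooth_Suc_D by blast+
  ultimately show ?case
    by (auto intro!: exI[of _ "\<lambda>s. b (f s) (g' s) + b (f' s) (g s)"] k_smooth_add Suc.IH
        bounded_bilinear.has_vector_derivative[OF assms])
qed simp

text \<open>The derivative of 1/f again contains 1/f, but only to order \<open>k\<close>, which is
  what the induction hypothesis for the same \<open>f\<close> supplies.\<close>

lemma k_smooth_inverse:
  fixes f :: "real \<Rightarrow> real"
  assumes "\<And>s. f s \<noteq> 0"
  shows "k_smooth k f \<Longrightarrow> k_smooth k (\<lambda>s. inverse (f s))"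
proof (induction k)
  case (Suc k)
  then obtain f' where f': "\<And>s. (f has_vector_derivative f' s) (at s)" "k_smooth k f'"
    by auto
  have "k_smooth k f"
    using Suc.prems k_smooth_Suc_D by blast
  have "k_smooth k (\<lambda>s. - (inverse (f s) * f' s * inverse (f s)))"
    by (intro k_smooth_linear[OF bounded_linear_minus[OF bounded_linear_ident]]
        k_smooth_bilinear[OF bounded_bilinear_mult] Suc.IH f' \<open>k_smooth k f\<close>)
  moreover have "((\<lambda>s. inverse (f s)) has_vector_derivative - (inverse (f s) * f' s * inverse (f s))) (at s)"
    for s
    using DERIV_inverse'[of f "f' s" s UNIV] f'(1)[of s] assms[of s]
    by (simp add: has_real_derivative_iff_has_vector_derivative)
  ultimately show ?case
    by (auto intro!: exI[of _ "\<lambda>s. - (inverse (f s) * f' s * inverse (f s))"]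
        simp del: mult_minus_left mult_minus_right)
qed simp

lemma k_smooth_Pair:
  assumes "k_smooth k f" "k_smooth k g"
  shows "k_smooth k (\<lambda>s. (f s, g s))"
proof -
  \<comment> \<open>A pair is the sum of its two linear embeddings, so no separate induction is
    required.\<close>
  have "bounded_linear (\<lambda>x::'a. (x, 0::'b))" "bounded_linear (\<lambda>y::'b. (0::'a, y))"
    by (intro bounded_linear_Pair bounded_linear_ident bounded_linear_zero)+
  from k_smooth_add[OF k_smooth_linear[OF this(1) assms(1)] k_smooth_linear[OF this(2) assms(2)]]
  show ?thesis by simp
qed

lemma has_vector_derivative_affine:
  fixes f :: "real \<Rightarrow> 'a::real_normed_vector"
  assumes "(f has_vector_derivative v) (at (c * s + a))"
  shows "((\<lambda>r. f (c * r + a)) has_vector_derivative c *\<^sub>R v) (at s)"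
proof -
  have "((\<lambda>r. c * r + a) has_vector_derivative c) (at s)"
    by (auto intro!: derivative_eq_intros)
  from vector_diff_chain_at[OF this assms] show ?thesis
    by (simp add: o_def)
qed

lemma k_smooth_affine: "k_smooth k f \<Longrightarrow> k_smooth k (\<lambda>s. f (c * s + a))"
proof (induction k arbitrary: f)
  case (Suc k)
  then obtain f' where "\<And>s. (f has_vector_derivative f' s) (at s)" "k_smooth k f'"
    by auto
  then show ?case
    by (auto intro!: exI[of _ "\<lambda>s. c *\<^sub>R f' (c * s + a)"] has_vector_derivative_affine
        k_smooth_linear[OF bounded_linear_scaleR_right] Suc.IH)
qed simp

section \<open>The action of O(2) on loops\<close>

lemma norm_circ [simp]: "norm (circ s) = 1"
  by (simp add: circ_def norm_eq_1 inner_vec_def sum_2 flip: power2_eq_square)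

lemma S1_circE:
  assumes "t \<in> S1"
  obtains s where "t = circ s"
proof -
  from assms have "norm t = 1" by simp
  then have "(t $ 1)\<^sup>2 + (t $ 2)\<^sup>2 = 1"
    by (simp add: norm_eq_1 inner_vec_def sum_2 power2_eq_square)
  then obtain s where "t $ 1 = cos s" "t $ 2 = sin s"
    using sincos_total_2pi by metis
  then have "t = circ s"
    by (simp add: circ_def vec_eq_iff forall_2)
  then show ?thesis by (rule that)
qed

text \<open>The first column of \<open>g\<close> is a unit vector with some angle \<open>a\<close>;
  orthogonality and the determinant then fix the second column.\<close>

lemma O2_circ:
  assumes "g \<in> O2"
  obtains \<sigma> a where "\<sigma> = det g" "\<sigma> = 1 \<or> \<sigma> = - 1" "\<And>s. g *v circ s = circ (\<sigma> * s + a)"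
proof -
  have orth: "orthogonal_matrix g"
    using assms by (simp add: O2_def)
  have det: "det g = 1 \<or> det g = - 1"
    using orth by (rule det_orthogonal_matrix)
  have "transpose g ** g = mat 1"
    using orth by (simp add: orthogonal_matrix)
  then have "(transpose g ** g) $ i $ j = (mat 1 :: real^2^2) $ i $ j" for i j
    by simp
  from this[of 1 1] this[of 1 2] this[of 2 2]
  have cols: "(g$1$1)\<^sup>2 + (g$2$1)\<^sup>2 = 1" "g$1$1 * g$1$2 + g$2$1 * g$2$2 = 0"
    by (simp_all add: matrix_matrix_mult_def transpose_def mat_def sum_2 power2_eq_square)
  obtain a where a: "g$1$1 = cos a" "g$2$1 = sin a"
    using sincos_total_2pi[OF cols(1)] by metis
  define d where "d = det g"
  have d: "cos a * g$2$2 - sin a * g$1$2 = d"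
    using a by (simp add: d_def det_2 mult.commute)
  have o: "cos a * g$1$2 + sin a * g$2$2 = 0"
    using cols a by simp
  \<comment> \<open>The equations \<open>o\<close> and \<open>d\<close> form a linear system in the
    second column whose matrix is a rotation; multiplying by its transpose solves it.\<close>
  have "cos a * (cos a * g$1$2 + sin a * g$2$2) - sin a * (cos a * g$2$2 - sin a * g$1$2)
      = ((cos a)\<^sup>2 + (sin a)\<^sup>2) * g$1$2"
    by (simp only: algebra_simps power2_eq_square)
  then have g12: "g$1$2 = - d * sin a"
    using o d by (simp add: mult.commute)
  have "sin a * (cos a * g$1$2 + sin a * g$2$2) + cos a * (cos a * g$2$2 - sin a * g$1$2)
      = ((cos a)\<^sup>2 + (sin a)\<^sup>2) * g$2$2"
    by (simp only: algebra_simps power2_eq_square)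
  then have g22: "g$2$2 = d * cos a"
    using o d by (simp add: mult.commute)
  have "g *v circ s = circ (d * s + a)" for s
    using det unfolding d_def[symmetric]
    by (auto simp: vec_eq_iff forall_2 matrix_vector_mult_def sum_2 circ_def a g12 g22
        cos_add sin_add cos_diff sin_diff algebra_simps)
  with that[of d a] det show ?thesis
    by (simp add: d_def)
qed

section \<open>Actions on loops induced by an involution\<close>

lemma eps_O2: "g \<in> O2 \<Longrightarrow> eps g = (if det g = 1 then 0 else 1)"
  using det_orthogonal_matrix[of g] by (auto simp: eps_def O2_def)

lemma O2_mult_S1: "g \<in> O2 \<Longrightarrow> t \<in> S1 \<Longrightarrow> g *v t \<in> S1"
  by (elim S1_circE O2_circ) auto

lemma O2_mult: "g \<in> O2 \<Longrightarrow> h \<in> O2 \<Longrightarrow> g ** h \<in> O2"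
  by (simp add: O2_def orthogonal_matrix_mul)

text \<open>Both sides of the composition law evaluate \<open>w\<close> at g(h t), and det is
  multiplicative. The case using the involution is that of two reflections, where \<open>F\<close>
  is applied twice on one side and not at all on the other.\<close>

lemma is_O2_actionI:
  assumes invol: "\<forall>z\<in>M. F (F z) = z"
    and vals: "\<forall>w\<in>L. \<forall>t\<in>S1. w t \<in> M"
    and closed: "\<And>g w. g \<in> O2 \<Longrightarrow> w \<in> L \<Longrightarrow> loop_act F g w \<in> L"
  shows "is_O2_action L (loop_act F)"
  unfolding is_O2_action_def
proof (intro conjI ballI)
  fix w :: "real^2 \<Rightarrow> 'a" and t :: "real^2"
  have "eps (mat 1) = 0"
    by (simp add: eps_def)
  then show "loop_act F (mat 1) w t = w t"
    by (simp add: loop_act_def)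
next
  fix g h w t
  assume g: "g \<in> O2" and h: "h \<in> O2" and w: "w \<in> L" and t: "t \<in> S1"
  \<comment> \<open>\<open>F\<close> is an involution on \<open>M\<close> only, so the value to
    which it is applied has to be located there.\<close>
  have "w (g *v (h *v t)) \<in> M"
    using g h w t vals O2_mult_S1 by blast
  moreover have "det g = 1 \<or> det g = - 1" "det h = 1 \<or> det h = - 1"
    using g h det_orthogonal_matrix by (auto simp: O2_def)
  ultimately show "loop_act F (g ** h) w t = loop_act F h (loop_act F g w) t"
    using invol g h O2_mult[OF g h]
    by (elim disjE) (simp_all add: loop_act_def eps_O2 det_mul matrix_vector_mul_assoc)
qed (use closed in auto)

lemma loop_act_values:
  assumes "\<forall>z\<in>M. F z \<in> M" "\<forall>t\<in>S1. w t \<in> M" "g \<in> O2" "t \<in> S1"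
  shows "loop_act F g w t \<in> M"
  using assms O2_mult_S1[of g t] by (auto simp: loop_act_def eps_O2)

text \<open>In the angle variable the action is an affine change of time followed by a linear map.
  \<open>F\<close> is replaced by its linear extension \<open>L\<close> from \<open>M\<close>,
  because \<open>Bbar\<close> is known to be linear only on the cotangent bundle.\<close>

lemma loop_act_circ:
  assumes "g \<in> O2" "\<forall>z\<in>M. F z = L z" "\<forall>t\<in>S1. w t \<in> M"
  obtains \<sigma> a where "\<sigma> = 1 \<or> \<sigma> = - 1"
    "\<And>s. loop_act F g w (circ s) = (if \<sigma> = 1 then id else L) (w (circ (\<sigma> * s + a)))"
proof -
  obtain \<sigma> a where "\<sigma> = det g" "\<sigma> = 1 \<or> \<sigma> = - 1" "\<And>s. g *v circ s = circ (\<sigma> * s + a)"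
    using O2_circ[OF assms(1)] by metis
  with that[of \<sigma> a] assms show ?thesis
    by (auto simp: loop_act_def eps_O2)
qed

lemma loop_act_smooth_loops:
  assumes "\<forall>z\<in>M. F z \<in> M" "bounded_linear L" "\<forall>z\<in>M. F z = L z"
    and "g \<in> O2" and w: "w \<in> smooth_loops M"
  shows "loop_act F g w \<in> smooth_loops M"
proof -
  have vals: "\<forall>t\<in>S1. w t \<in> M"
    using w by (simp add: smooth_loops_def)
  obtain \<sigma> a where "\<sigma> = 1 \<or> \<sigma> = - 1" and
    act: "\<And>s. loop_act F g w (circ s) = (if \<sigma> = 1 then id else L) (w (circ (\<sigma> * s + a)))"
    by (rule loop_act_circ[OF assms(4,3) vals]) (rule that)
  have "bounded_linear (if \<sigma> = 1 then id else L)"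
    using assms(2) by (simp add: id_def bounded_linear_ident)
  then have "k_smooth k (\<lambda>s. loop_act F g w (circ s))" for k
    unfolding act
  proof (rule k_smooth_linear)
    show "k_smooth k (\<lambda>s. w (circ (\<sigma> * s + a)))"
      using w k_smooth_affine[of k "\<lambda>s. w (circ s)"]
      by (simp add: smooth_loops_def smooth_curve_iff_k_smooth)
  qed
  moreover have "\<forall>t\<in>S1. loop_act F g w t \<in> M"
    using loop_act_values[OF assms(1) vals assms(4)] by blast
  ultimately show ?thesis
    by (simp add: smooth_loops_def smooth_curve_iff_k_smooth)
qed

section \<open>The Birkhoff involution\<close>

text \<open>The linear isometry underlying both \<open>rho\<close> and
  \<open>birkhoff\<close>.\<close>

definition reflect1 :: "(nat \<Rightarrow> 'n::finite) \<Rightarrow> real^'n \<Rightarrow> real^'n" where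
  "reflect1 ix x = (\<chi> i. if i = ix 1 then - x $ i else x $ i)"

lemma linear_reflect1: "linear (reflect1 ix)"
  by (rule linearI) (auto simp: reflect1_def vec_eq_iff)

lemma reflect1_reflect1 [simp]: "reflect1 ix (reflect1 ix x) = x"
  by (simp add: reflect1_def vec_eq_iff)

lemma inner_reflect1 [simp]: "reflect1 ix x \<bullet> reflect1 ix y = x \<bullet> y"
  by (auto simp: reflect1_def inner_vec_def intro!: sum.cong)

lemma norm_reflect1 [simp]: "norm (reflect1 ix x) = norm x"
  by (simp add: norm_eq_sqrt_inner)

lemma reflect1_earth_moon [simp]:
  "reflect1 ix (earth ix \<mu>) = - earth ix \<mu>" "reflect1 ix (moon ix \<mu>) = - moon ix \<mu>"
  by (auto simp: reflect1_def earth_def moon_def vec_eq_iff axis_def)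

lemma birkhoff_eq: "birkhoff ix z = (- reflect1 ix (fst z), reflect1 ix (snd z))"
  by (cases z) (simp add: birkhoff_def reflect1_def vec_eq_iff)

lemma bounded_linear_birkhoff: "bounded_linear (birkhoff ix)"
proof -
  have "bounded_linear (reflect1 ix)"
    using linear_reflect1 by (simp add: linear_conv_bounded_linear)
  then show ?thesis
    unfolding birkhoff_eq[abs_def]
    by (intro bounded_linear_Pair bounded_linear_minus)
      (auto intro: bounded_linear_compose bounded_linear_fst bounded_linear_snd)
qed

lemma birkhoff_birkhoff [simp]: "birkhoff ix (birkhoff ix z) = z"
  by (simp add: birkhoff_eq linear_neg[OF linear_reflect1])

lemma omega_R_birkhoff: "omega_R (birkhoff ix u) (birkhoff ix v) = - omega_R u v"
  by (simp add: omega_R_def birkhoff_eq split_beta)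

text \<open>Such a centre \<open>c\<close> is fixed by the isometry -r that \<open>birkhoff\<close>
  induces on positions. Applied to earth and moon, this gives invariance of the phase space and of
  both potentials.\<close>

lemma norm_birkhoff_diff:
  assumes "reflect1 ix c = - c"
  shows "norm (fst (birkhoff ix z) - c) = norm (fst z - c)"
proof -
  have "fst (birkhoff ix z) - c = - reflect1 ix (fst z - c)"
    using assms by (simp add: birkhoff_eq linear_diff[OF linear_reflect1])
  then show ?thesis
    by (simp only: norm_minus_cancel norm_reflect1)
qed

lemma birkhoff_phase_space:
  assumes "z \<in> phase_space ix \<mu>"
  shows "birkhoff ix z \<in> phase_space ix \<mu>"
  using assms norm_birkhoff_diff[of ix "earth ix \<mu>" z] norm_birkhoff_diff[of ix "moon ix \<mu>" z]
  by (auto simp: phase_space_def mem_Times_iff)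

lemma Ham_birkhoff:
  assumes "ix 1 \<noteq> ix 2"
  shows "Ham ix \<mu> (birkhoff ix z) = Ham ix \<mu> z"
proof -
  have "norm (snd (birkhoff ix z)) = norm (snd z)"
    by (simp add: birkhoff_eq)
  \<comment> \<open>Each product is invariant by itself: p_1 and q_2 both change sign, p_2 and q_1
    do not. That \<open>ix 1\<close> and \<open>ix 2\<close> differ keeps the second axis apart from
    the reflected one.\<close>
  moreover have "snd (birkhoff ix z) $ ix 1 * fst (birkhoff ix z) $ ix 2
        - snd (birkhoff ix z) $ ix 2 * fst (birkhoff ix z) $ ix 1
      = snd z $ ix 1 * fst z $ ix 2 - snd z $ ix 2 * fst z $ ix 1"
    using assms by (simp add: birkhoff_eq reflect1_def)
  ultimately show ?thesis
    by (simp add: Ham_def split_beta norm_birkhoff_diff)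
qed

text \<open>An antisymplectic map preserving H reverses its Hamiltonian vector field; this is why
  the reflection must also reverse time.\<close>

lemma ham_vector_birkhoff:
  assumes "ix 1 \<noteq> ix 2" "ham_vector ix \<mu> z X"
  shows "ham_vector ix \<mu> (birkhoff ix z) (- birkhoff ix X)"
proof -
  obtain dH where dH: "(Ham ix \<mu> has_derivative dH) (at z)" "\<And>u. omega_R X u = dH u"
    using assms(2) by (auto simp: ham_vector_def)
  have "(birkhoff ix has_derivative birkhoff ix) (at (birkhoff ix z))"
    by (rule bounded_linear_imp_has_derivative[OF bounded_linear_birkhoff])
  moreover have "(Ham ix \<mu> has_derivative dH) (at (birkhoff ix (birkhoff ix z)))"
    using dH by simp
  ultimately have "(Ham ix \<mu> \<circ> birkhoff ix has_derivative dH \<circ> birkhoff ix) (at (birkhoff ix z))"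
    by (rule diff_chain_at)
  moreover have "Ham ix \<mu> \<circ> birkhoff ix = Ham ix \<mu>"
    using Ham_birkhoff[OF assms(1)] by auto
  moreover have "omega_R (- birkhoff ix X) u = dH (birkhoff ix u)" for u
  proof -
    \<comment> \<open>Writing \<open>u\<close> as the image of its own image lets antisymplecticity
      move the involution to the other argument.\<close>
    have "omega_R (- birkhoff ix X) u = - omega_R (birkhoff ix X) (birkhoff ix (birkhoff ix u))"
      by (simp add: omega_R_def split_beta)
    then show ?thesis
      by (simp only: omega_R_birkhoff dH minus_minus)
  qed
  ultimately show ?thesis
    by (auto simp: ham_vector_def o_def)
qed

section \<open>The involution of the cotangent bundle of the sphere\<close>

lemma rho_eq: "rho ix x = (reflect1 ix (fst x), snd x)"
  by (cases x) (simp add: rho_def reflect1_def)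

lemma bounded_linear_rho: "bounded_linear (rho ix)"
proof -
  have "linear (rho ix)"
    by (rule linearI) (auto simp: rho_eq linear_add[OF linear_reflect1] linear_cmul[OF linear_reflect1])
  then show ?thesis by (simp add: linear_conv_bounded_linear)
qed

lemma rho_rho [simp]: "rho ix (rho ix x) = x"
  by (simp add: rho_eq)

lemma inner_rho [simp]: "rho ix x \<bullet> rho ix y = x \<bullet> y"
  by (simp add: rho_eq inner_prod_def)

lemma inner_rho_left: "rho ix x \<bullet> y = x \<bullet> rho ix y"
  by (metis inner_rho rho_rho)

lemma rho_Sn: "x \<in> Sn \<Longrightarrow> rho ix x \<in> Sn"
  by (simp add: Sn_def norm_eq_1)

text \<open>The pole lies on the last axis, which the reflection fixes; hence collision times
  correspond to collision times.\<close>

lemma rho_eq_pole_iff: "rho ix x = pole \<longleftrightarrow> x = pole"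
proof -
  have "rho ix pole = pole"
    by (simp add: rho_eq pole_def linear_0[OF linear_reflect1])
  then show ?thesis by (metis rho_rho)
qed

text \<open>On the cotangent bundle the projection inside \<^const>\<open>ext_covector\<close> is vacuous, so there
  \<^const>\<open>Bbar\<close> is the restriction of this linear involution of the ambient space.\<close>

definition Bbar_lin :: "(nat \<Rightarrow> 'n::finite) \<Rightarrow> 'n covec \<Rightarrow> 'n covec" where
  "Bbar_lin ix z = (rho ix (fst z), - (snd z o\<^sub>L Blinfun (rho ix)))"

lemma fst_Bbar_lin [simp]: "fst (Bbar_lin ix z) = rho ix (fst z)"
  by (simp add: Bbar_lin_def)

lemma snd_Bbar_lin [simp]: "blinfun_apply (snd (Bbar_lin ix z)) v = - blinfun_apply (snd z) (rho ix v)"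
  by (simp add: Bbar_lin_def bounded_linear_rho bounded_linear_Blinfun_apply uminus_blinfun.rep_eq)

lemma covec_eqI:
  assumes "fst z = fst z'" "\<And>v. blinfun_apply (snd z) v = blinfun_apply (snd z') v"
  shows "z = z'"
  using assms by (intro prod_eqI blinfun_eqI)

lemma bounded_linear_Bbar_lin: "bounded_linear (Bbar_lin ix)"
  unfolding Bbar_lin_def[abs_def]
  by (intro bounded_linear_Pair bounded_linear_minus
      bounded_linear_compose[OF bounded_linear_rho bounded_linear_fst]
      bounded_linear_compose[OF bounded_bilinear.bounded_linear_left[OF bounded_bilinear_blinfun_compose] bounded_linear_snd])

lemma Bbar_lin_Bbar_lin [simp]: "Bbar_lin ix (Bbar_lin ix z) = z"
  by (rule covec_eqI) auto

lemma Bbar_eq_lin: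
  assumes "z \<in> TstarS"
  shows "Bbar ix z = Bbar_lin ix z"
proof -
  obtain x \<eta> where z: "z = (x, \<eta>)" and \<eta>: "blinfun_apply \<eta> x = 0"
    using assms by (auto simp: TstarS_def)
  have deriv: "frechet_derivative (rho ix) (at (rho ix x)) = rho ix"
    using frechet_derivative_at[OF bounded_linear_imp_has_derivative[OF bounded_linear_rho]]
    by metis
  \<comment> \<open>The projection subtracts a multiple of \<open>rho ix x\<close>, which
    \<open>rho\<close> sends to a multiple of \<open>x\<close>, where the covector vanishes.\<close>
  have "(\<lambda>v. (blinfun_apply \<eta> \<circ> rho ix) (v - (v \<bullet> rho ix x) *\<^sub>R rho ix x))
      = blinfun_apply (\<eta> o\<^sub>L Blinfun (rho ix))"
    using \<eta> by (simp add: fun_eq_iff bounded_linear_rho bounded_linear_Blinfun_apply blinfun.diff_right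
        blinfun.scaleR_right linear_diff[OF bounded_linear.linear[OF bounded_linear_rho]]
        linear_cmul[OF bounded_linear.linear[OF bounded_linear_rho]])
  then have "ext_covector (rho ix x) (blinfun_apply \<eta> \<circ> rho ix) = \<eta> o\<^sub>L Blinfun (rho ix)"
    by (simp only: ext_covector_def blinfun_apply_inverse)
  then show ?thesis
    by (simp add: z Bbar_def dstar_rho_def fiber_neg_def deriv Bbar_lin_def)
qed

lemma Bbar_lin_TstarS: "z \<in> TstarS \<Longrightarrow> Bbar_lin ix z \<in> TstarS"
  by (auto simp: TstarS_def Bbar_lin_def rho_Sn uminus_blinfun.rep_eq bounded_linear_rho
      bounded_linear_Blinfun_apply)

lemma antisymplectic_involution_Bbar:
  fixes ix :: "nat \<Rightarrow> 'n::finite"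
  shows "antisymplectic_involution TstarS omega_S (Bbar ix)"
  unfolding antisymplectic_involution_def
proof (intro conjI ballI)
  fix z :: "'n covec" assume z: "z \<in> TstarS"
  show "Bbar ix z \<in> TstarS" "Bbar ix (Bbar ix z) = z"
    using z Bbar_lin_TstarS[OF z, of ix] by (simp_all add: Bbar_eq_lin)
  have "(Bbar_lin ix has_derivative Bbar_lin ix) (at z within TstarS)"
    by (rule bounded_linear_imp_has_derivative[OF bounded_linear_Bbar_lin])
  then have "(Bbar ix has_derivative Bbar_lin ix) (at z within TstarS)"
    using z by (rule has_derivative_transform[rotated 2]) (rule Bbar_eq_lin)
  \<comment> \<open>In the pairing the two copies of \<open>rho\<close> cancel and the fiber sign
    survives, for all ambient vectors and so for tangent ones.\<close>
  moreover have "omega_S (Bbar_lin ix u) (Bbar_lin ix v) = - omega_S u v" for u v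
    by (simp add: omega_S_def split_beta)
  ultimately show "\<exists>D. (Bbar ix has_derivative D) (at z within TstarS) \<and>
      (\<forall>u\<in>tangent_vectors TstarS z. \<forall>v\<in>tangent_vectors TstarS z. omega_S (D u) (D v) = - omega_S u v)"
    by blast
qed

section \<open>The Moser embedding\<close>

definition conf_factor :: "real^'n::finite \<Rightarrow> real" where
  "conf_factor x = 2 / (x \<bullet> x + 1)"

lemma conf_factor_neq_0 [simp]: "conf_factor x \<noteq> 0"
  using add_nonneg_pos[OF inner_ge_zero[of x] zero_less_one] by (simp add: conf_factor_def)

text \<open>Eliminates |x|^2 in favour of the conformal factor, so that later verifications become
  identities of rational functions.\<close>

lemma inner_self_conf: "x \<bullet> x = 2 / conf_factor x - 1"
  by (simp add: conf_factor_def field_simps)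

definition sphere_param :: "real^'n::finite \<Rightarrow> 'n ambient" where
  "sphere_param x = (conf_factor x *\<^sub>R x, 1 - conf_factor x)"

lemma inner_sphere_param [simp]: "sphere_param x \<bullet> sphere_param x = 1"
  by (simp add: sphere_param_def inner_prod_def inner_self_conf[of x] field_simps)

lemma sphere_param_in: "sphere_param x \<in> Sn - {pole}"
  by (simp add: Sn_def norm_eq_1 pole_def) (simp add: sphere_param_def)

lemma stereo_sphere_param: "stereo (sphere_param x) = x"
  by (simp add: stereo_def sphere_param_def)

lemma sphere_param_stereo:
  assumes "w \<in> Sn - {pole}"
  shows "sphere_param (stereo w) = w"
proof -
  obtain p s where w: "w = (p, s)" by fastforce
  have sq: "p \<bullet> p + s * s = 1"
    using assms by (simp add: Sn_def norm_eq_1 w inner_prod_def)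
  have s: "s \<noteq> 1"
  proof
    assume "s = 1"
    with sq have "p = 0" by simp
    with \<open>s = 1\<close> assms show False by (simp add: w pole_def)
  qed
  \<comment> \<open>The sphere equation factors p.p as (1 + s)(1 - s); one factor cancels and the
    conformal factor comes out as 1 - s.\<close>
  have "stereo w \<bullet> stereo w = (p \<bullet> p) / ((1 - s) * (1 - s))"
    by (simp add: stereo_def w divide_inverse_commute)
  also have "\<dots> = ((1 + s) * (1 - s)) / ((1 - s) * (1 - s))"
    using sq by (simp add: algebra_simps)
  also have "\<dots> = (1 + s) / (1 - s)"
    using s by simp
  finally have "stereo w \<bullet> stereo w + 1 = 2 / (1 - s)"
    using s by (simp add: field_simps)
  then have "conf_factor (stereo w) = 1 - s"
    by (simp add: conf_factor_def)
  then show ?thesis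
    using s by (simp add: sphere_param_def w stereo_def)
qed

lemma stereo_inv_eq: "stereo_inv = sphere_param"
proof
  fix x :: "real^'n"
  have "inj_on stereo (Sn - {pole :: 'n ambient})"
    by (rule inj_on_inverseI[of _ sphere_param]) (rule sphere_param_stereo)
  then show "stereo_inv x = sphere_param x"
    unfolding stereo_inv_def
    by (rule inv_into_f_eq) (rule sphere_param_in stereo_sphere_param)+
qed

section \<open>The differential of the chart and its cotangent lift\<close>

definition d_sphere_param :: "real^'n::finite \<Rightarrow> real^'n \<Rightarrow> 'n ambient" where
  "d_sphere_param x u =
     (conf_factor x *\<^sub>R u - ((conf_factor x)\<^sup>2 * (x \<bullet> u)) *\<^sub>R x, (conf_factor x)\<^sup>2 * (x \<bullet> u))"

lemma has_derivative_conf_factor: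
  "(conf_factor has_derivative (\<lambda>u. - ((conf_factor x)\<^sup>2 * (x \<bullet> u)))) (at x)"
proof -
  have "x \<bullet> x + 1 \<noteq> 0"
    using inner_ge_zero[of x] by linarith
  then show ?thesis
    unfolding conf_factor_def[abs_def]
    by (auto intro!: derivative_eq_intros simp: fun_eq_iff power2_eq_square field_simps inner_commute)
qed

lemma has_derivative_sphere_param: "(sphere_param has_derivative d_sphere_param x) (at x)"
  unfolding sphere_param_def[abs_def] d_sphere_param_def[abs_def]
  by (auto intro!: derivative_eq_intros has_derivative_conf_factor simp: algebra_simps)

text \<open>\<open>inv\<close> is meaningful only on the range of the injective differential, the
  tangent space, whence the orthogonality hypothesis. Adding \<open>snd w\<close> times
  \<open>x\<close> cancels the radial term of the differential and leaves the conformal factor times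
  \<open>u\<close>.\<close>

lemma inv_d_sphere_param:
  assumes "w \<bullet> sphere_param x = 0"
  shows "inv (d_sphere_param x) w = (fst w + snd w *\<^sub>R x) /\<^sub>R conf_factor x"
proof -
  have left_inv: "(fst v + snd v *\<^sub>R x) /\<^sub>R conf_factor x = u" if "v = d_sphere_param x u" for u v
    by (simp add: that d_sphere_param_def)
  then have "inj (d_sphere_param x)"
    by (metis injI)
  moreover have "d_sphere_param x ((fst w + snd w *\<^sub>R x) /\<^sub>R conf_factor x) = w"
  proof -
    have "x \<bullet> fst w = snd w - snd w / conf_factor x"
      using assms
      by (simp add: sphere_param_def inner_prod_def inner_commute field_simps)
    then have "x \<bullet> (fst w + snd w *\<^sub>R x)
        = snd w - snd w / conf_factor x + snd w * (2 / conf_factor x - 1)"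
      by (simp add: inner_add_right inner_self_conf[of x])
    also have "\<dots> = snd w / conf_factor x"
      by (simp add: field_simps)
    finally have "(conf_factor x)\<^sup>2 * (x \<bullet> ((fst w + snd w *\<^sub>R x) /\<^sub>R conf_factor x)) = snd w"
      by (simp add: power2_eq_square)
    then show ?thesis
      by (intro prod_eqI) (simp_all add: d_sphere_param_def)
  qed
  ultimately show ?thesis
    by (rule inv_f_eq)
qed

text \<open>The chart is conformal, so the inverse transpose of its differential is the differential
  divided by the squared conformal factor: this is that quotient at \<open>y\<close>, with (|x|^2 +
  1)/2 as the reciprocal factor.\<close>

definition fiber_vec :: "real^'n::finite \<Rightarrow> real^'n \<Rightarrow> 'n ambient" where
  "fiber_vec x y = (((x \<bullet> x + 1) / 2) *\<^sub>R y - (x \<bullet> y) *\<^sub>R x, x \<bullet> y)"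

text \<open>In the chart the cotangent lift is \<open>y \<circ> (d\<sigma>\<^sub>x)\<^sup>-\<^sup>1\<close>; its representing tangent vector is
  polynomial in \<open>(x, y)\<close>, from which both smoothness and equivariance can be read off.\<close>

lemma iota_map_eq: "iota_map (x, y) = (sphere_param x, blinfun_inner_right (fiber_vec x y))"
proof -
  let ?w = "\<lambda>v. v - (v \<bullet> sphere_param x) *\<^sub>R sphere_param x"
  have deriv: "frechet_derivative stereo_inv (at x) = d_sphere_param x"
    unfolding stereo_inv_eq
    using frechet_derivative_at[OF has_derivative_sphere_param] by metis
  have "y \<bullet> inv (d_sphere_param x) (?w v) = fiber_vec x y \<bullet> v" for v
  proof -
    \<comment> \<open>\<open>?w\<close> is the tangential projection in \<open>ext_covector\<close>,
      so the inverse is evaluated only on tangent vectors.\<close>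
    have "?w v \<bullet> sphere_param x = 0"
      by (simp add: inner_diff_left)
    then have "y \<bullet> inv (d_sphere_param x) (?w v) = y \<bullet> ((fst (?w v) + snd (?w v) *\<^sub>R x) /\<^sub>R conf_factor x)"
      by (simp only: inv_d_sphere_param)
    also have "\<dots> = fiber_vec x y \<bullet> v"
      by (simp add: sphere_param_def fiber_vec_def inner_prod_def inner_self_conf[of x] inner_add_left
          inner_add_right inner_diff_left inner_diff_right inner_commute field_simps)
    finally show ?thesis .
  qed
  then have "ext_covector (sphere_param x) ((\<lambda>u. y \<bullet> u) \<circ> inv (d_sphere_param x))
      = blinfun_inner_right (fiber_vec x y)"
    unfolding ext_covector_def
    by (simp add: blinfun_apply_inverse flip: blinfun_inner_right.rep_eq)
  then show ?thesis
    by (simp add: iota_map_def deriv flip: stereo_inv_eq)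
qed

lemma iota_map_TstarS: "iota_map z \<in> TstarS"
proof (cases z)
  case (Pair x y)
  have "fiber_vec x y \<bullet> sphere_param x = 0"
    by (simp add: sphere_param_def fiber_vec_def inner_prod_def inner_self_conf[of x]
        inner_diff_left inner_diff_right inner_commute field_simps)
  with sphere_param_in[of x] show ?thesis
    by (simp add: Pair iota_map_eq TstarS_def)
qed

section \<open>Equivariance and smoothness of the Moser embedding\<close>

lemma Bbar_iota_phi:
  "Bbar ix (iota_map (phi_map ix \<mu> z)) = iota_map (phi_map ix \<mu> (birkhoff ix z))"
proof -
  define x y where "x = - snd z" and "y = fst z - earth ix \<mu>"
  have phi: "phi_map ix \<mu> z = (x, y)"
    by (simp add: phi_map_def split_beta x_def y_def)
  have phi_B: "phi_map ix \<mu> (birkhoff ix z) = (reflect1 ix x, - reflect1 ix y)"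
    by (simp add: phi_map_def birkhoff_eq x_def y_def linear_neg[OF linear_reflect1]
        linear_diff[OF linear_reflect1])
  \<comment> \<open>The reflection preserves inner products, hence all scalar coefficients; only the
    vectors \<open>x\<close> and \<open>y\<close> are reflected.\<close>
  have "sphere_param (reflect1 ix x) = rho ix (sphere_param x)"
    by (simp add: sphere_param_def rho_eq conf_factor_def linear_cmul[OF linear_reflect1])
  moreover have "fiber_vec (reflect1 ix x) (- reflect1 ix y) = - rho ix (fiber_vec x y)"
    by (simp add: fiber_vec_def rho_eq linear_cmul[OF linear_reflect1] linear_diff[OF linear_reflect1])
  ultimately show ?thesis
    unfolding Bbar_eq_lin[OF iota_map_TstarS] phi phi_B
    by (intro covec_eqI) (simp_all add: iota_map_eq inner_rho_left)
qed

lemma k_smooth_iota_map: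
  assumes x: "k_smooth k x" and y: "k_smooth k y"
  shows "k_smooth k (\<lambda>s. iota_map (x s, y s))"
proof -
  note bilinear = k_smooth_bilinear[OF bounded_bilinear_inner]
    k_smooth_bilinear[OF bounded_bilinear_mult] k_smooth_bilinear[OF bounded_bilinear_scaleR]
  have minus: "k_smooth k (\<lambda>s. - f s)" if "k_smooth k f" for f :: "real \<Rightarrow> 'b::real_normed_vector"
    by (rule k_smooth_linear[OF bounded_linear_minus[OF bounded_linear_ident] that])
  have sq: "k_smooth k (\<lambda>s. x s \<bullet> x s + 1)"
    by (intro k_smooth_add bilinear k_smooth_const x)
  moreover have "x s \<bullet> x s + 1 \<noteq> 0" for s
    using inner_ge_zero[of "x s"] by linarith
  ultimately have inverse: "k_smooth k (\<lambda>s. inverse (x s \<bullet> x s + 1))"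
    by (rule k_smooth_inverse[rotated])
  have cf: "k_smooth k (\<lambda>s. conf_factor (x s))"
    unfolding conf_factor_def divide_inverse
    by (intro bilinear k_smooth_const inverse)
  have "k_smooth k (\<lambda>s. sphere_param (x s))"
    unfolding sphere_param_def diff_conv_add_uminus
    by (intro k_smooth_Pair k_smooth_add bilinear minus k_smooth_const cf x)
  moreover have "k_smooth k (\<lambda>s. fiber_vec (x s) (y s))"
    unfolding fiber_vec_def diff_conv_add_uminus divide_inverse
    by (intro k_smooth_Pair k_smooth_add bilinear minus k_smooth_const x y)
  ultimately show ?thesis
    unfolding iota_map_eq
    by (intro k_smooth_Pair k_smooth_linear[OF bounded_linear_blinfun_inner_right])
qed

lemma iota_phi_smooth_loops:
  assumes "v \<in> smooth_loops M"
  shows "iota_map \<circ> phi_map ix \<mu> \<circ> v \<in> smooth_loops TstarS"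
proof -
  have v: "k_smooth k (\<lambda>s. v (circ s))" for k
    using assms by (simp add: smooth_loops_def smooth_curve_iff_k_smooth)
  have "k_smooth k (\<lambda>s. iota_map (- snd (v (circ s)), fst (v (circ s)) + - earth ix \<mu>))" for k
    by (intro k_smooth_iota_map k_smooth_add k_smooth_const
        k_smooth_linear[OF bounded_linear_fst v]
        k_smooth_linear[OF bounded_linear_minus[OF bounded_linear_snd] v])
  then show ?thesis
    by (simp add: smooth_loops_def smooth_curve_iff_k_smooth iota_map_TstarS phi_map_def split_beta)
qed

section \<open>Periodic trajectories\<close>

text \<open>Shared by both classes of trajectories: \<open>a\<close> is 1 for periodic ones and any
  positive time change for regularized ones. The sign of time reversal is absorbed into the
  Hamiltonian vector, so \<open>a\<close> itself is unchanged.\<close>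

lemma ham_vector_affine_time:
  fixes ix :: "nat \<Rightarrow> 'n::finite" and b s :: real
  assumes "ix 1 \<noteq> ix 2" "\<sigma> = 1 \<or> \<sigma> = - 1"
    and X: "ham_vector ix \<mu> (z (\<sigma> * s + b)) X"
    and z: "(z has_vector_derivative a *\<^sub>R X) (at (\<sigma> * s + b))"
  defines "J \<equiv> (if \<sigma> = 1 then id else birkhoff ix)"
  shows "ham_vector ix \<mu> (J (z (\<sigma> * s + b))) (\<sigma> *\<^sub>R J X)"
    and "((\<lambda>r. J (z (\<sigma> * r + b))) has_vector_derivative a *\<^sub>R (\<sigma> *\<^sub>R J X)) (at s)"
proof -
  show "ham_vector ix \<mu> (J (z (\<sigma> * s + b))) (\<sigma> *\<^sub>R J X)"
    using assms(2) X ham_vector_birkhoff[OF assms(1) X] by (auto simp: J_def)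
  have J: "bounded_linear J"
    by (simp add: J_def bounded_linear_birkhoff id_def bounded_linear_ident)
  show "((\<lambda>r. J (z (\<sigma> * r + b))) has_vector_derivative a *\<^sub>R (\<sigma> *\<^sub>R J X)) (at s)"
    using bounded_linear.has_vector_derivative[OF J has_vector_derivative_affine[OF z]]
    by (simp add: linear_cmul[OF bounded_linear.linear[OF J]] mult.commute)
qed

lemma loop_act_periodic_trajectories:
  fixes ix :: "nat \<Rightarrow> 'n::finite"
  assumes ix: "ix 1 \<noteq> ix 2" and "\<tau> > 0" and g: "g \<in> O2"
    and v: "v \<in> periodic_trajectories ix \<mu> \<tau>"
  shows "loop_act (birkhoff ix) g v \<in> periodic_trajectories ix \<mu> \<tau>"
proof -
  have loop: "v \<in> smooth_loops (phase_space ix \<mu>)"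
    and traj: "trajectory ix \<mu> (\<lambda>t. v (circ (2 * pi * t / \<tau>)))"
    using v by (auto simp: periodic_trajectories_def)
  have vals: "\<forall>t\<in>S1. v t \<in> phase_space ix \<mu>"
    using loop by (simp add: smooth_loops_def)
  obtain \<sigma> a where \<sigma>: "\<sigma> = 1 \<or> \<sigma> = - 1" and act:
    "\<And>s. loop_act (birkhoff ix) g v (circ s)
       = (if \<sigma> = 1 then id else birkhoff ix) (v (circ (\<sigma> * s + a)))"
    by (rule loop_act_circ[OF g _ vals, of "birkhoff ix" "birkhoff ix"]) auto
  \<comment> \<open>The angle shift \<open>a\<close> in units of time: a full turn takes time
    \<tau>.\<close>
  define b where "b = a * \<tau> / (2 * pi)"
  have time: "\<sigma> * (2 * pi * t / \<tau>) + a = 2 * pi * (\<sigma> * t + b) / \<tau>" for t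
    using \<open>\<tau> > 0\<close> by (simp add: b_def field_simps)
  have "trajectory ix \<mu> (\<lambda>t. loop_act (birkhoff ix) g v (circ (2 * pi * t / \<tau>)))"
    unfolding trajectory_def
  proof (intro allI conjI)
    fix t
    show "loop_act (birkhoff ix) g v (circ (2 * pi * t / \<tau>)) \<in> phase_space ix \<mu>"
      by (rule loop_act_values[OF _ vals g]) (simp_all add: birkhoff_phase_space)
    obtain X where
      "ham_vector ix \<mu> (v (circ (2 * pi * (\<sigma> * t + b) / \<tau>))) X"
      "((\<lambda>t. v (circ (2 * pi * t / \<tau>))) has_vector_derivative 1 *\<^sub>R X) (at (\<sigma> * t + b))"
      using traj unfolding trajectory_def scaleR_one by blast
    from ham_vector_affine_time[where z = "\<lambda>t. v (circ (2 * pi * t / \<tau>))", OF ix \<sigma> this]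
    show "\<exists>X. ham_vector ix \<mu> (loop_act (birkhoff ix) g v (circ (2 * pi * t / \<tau>))) X \<and>
        ((\<lambda>t. loop_act (birkhoff ix) g v (circ (2 * pi * t / \<tau>))) has_vector_derivative X) (at t)"
      unfolding act time scaleR_one by blast
  qed
  moreover have "loop_act (birkhoff ix) g v \<in> smooth_loops (phase_space ix \<mu>)"
    by (rule loop_act_smooth_loops[OF _ bounded_linear_birkhoff[of ix] _ g loop])
      (simp_all add: birkhoff_phase_space)
  ultimately show ?thesis
    by (simp add: periodic_trajectories_def)
qed

section \<open>The regularized problem\<close>

text \<open>Equivariance preserves the image of \<open>S\<close>, and continuity extends this to the
  closure. The linear extension is used since the closure is taken in the ambient space.\<close>

lemma Bbar_lin_moser_reg:
  assumes "birkhoff ix ` S = S" "z \<in> moser_reg ix \<mu> S"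
  shows "Bbar_lin ix z \<in> moser_reg ix \<mu> S"
proof -
  let ?A = "(iota_map \<circ> phi_map ix \<mu>) ` S"
  have "Bbar_lin ix ((iota_map \<circ> phi_map ix \<mu>) z) = (iota_map \<circ> phi_map ix \<mu>) (birkhoff ix z)" for z
    using Bbar_iota_phi[of ix \<mu> z] by (simp add: Bbar_eq_lin iota_map_TstarS)
  then have "Bbar_lin ix ` ?A = (iota_map \<circ> phi_map ix \<mu>) ` birkhoff ix ` S"
    by (simp add: image_image)
  then have "Bbar_lin ix ` closure ?A \<subseteq> closure ?A"
    using closure_bounded_linear_image_subset[OF bounded_linear_Bbar_lin, of ix ?A] assms(1) by simp
  with assms(2) show ?thesis
    by (auto simp: moser_reg_def Bbar_lin_TstarS)
qed

lemma moser_reg_TstarS: "moser_reg ix \<mu> S \<subseteq> TstarS"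
  by (simp add: moser_reg_def)

lemma Bbar_moser_reg:
  assumes "birkhoff ix ` S = S"
  shows "Bbar ix ` moser_reg ix \<mu> S = moser_reg ix \<mu> S"
proof -
  have eq: "Bbar ix z = Bbar_lin ix z" if "z \<in> moser_reg ix \<mu> S" for z
    using that moser_reg_TstarS Bbar_eq_lin by blast
  show ?thesis
  proof (intro equalityI subsetI)
    fix z assume "z \<in> moser_reg ix \<mu> S"
    \<comment> \<open>For an involution, the image of a point is also its preimage, so invariance
      gives surjectivity.\<close>
    then have "Bbar ix (Bbar_lin ix z) = z" "Bbar_lin ix z \<in> moser_reg ix \<mu> S"
      using Bbar_lin_moser_reg[OF assms] by (simp_all add: eq)
    then show "z \<in> Bbar ix ` moser_reg ix \<mu> S"
      by (metis imageI)
  qed (use Bbar_lin_moser_reg[OF assms] eq in auto)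
qed

text \<open>Each defining clause is carried along by the affine change of time together with the
  involution; local lifts to phase space are moved by \<open>birkhoff\<close>.\<close>

lemma loop_act_regularized_trajectories:
  fixes ix :: "nat \<Rightarrow> 'n::finite"
  assumes ix: "ix 1 \<noteq> ix 2" and S: "birkhoff ix ` S = S" and g: "g \<in> O2"
    and w: "w \<in> regularized_trajectories ix \<mu> S"
  shows "loop_act (Bbar ix) g w \<in> regularized_trajectories ix \<mu> S"
proof -
  let ?w' = "loop_act (Bbar ix) g w"
  let ?M = "moser_reg ix \<mu> S"
  have loop: "w \<in> smooth_loops ?M"
    and immersed: "\<And>s. vector_derivative (\<lambda>r. w (circ r)) (at s) \<noteq> 0"
    and dense: "closure {s. fst (w (circ s)) \<noteq> pole} = UNIV"
    and traj: "\<And>s. fst (w (circ s)) \<noteq> pole \<Longrightarrow>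
            (\<exists>z a X. (\<forall>\<^sub>F r in nhds s. (iota_map \<circ> phi_map ix \<mu>) (z r) = w (circ r)) \<and>
               z s \<in> phase_space ix \<mu> \<and> a > 0 \<and> ham_vector ix \<mu> (z s) X \<and>
               (z has_vector_derivative a *\<^sub>R X) (at s))"
    using w by (auto simp: regularized_trajectories_def)
  have vals: "\<forall>t\<in>S1. w t \<in> ?M"
    using loop by (simp add: smooth_loops_def)
  have lin: "\<forall>z\<in>?M. Bbar ix z = Bbar_lin ix z"
    using moser_reg_TstarS Bbar_eq_lin by blast
  obtain \<sigma> b where \<sigma>: "\<sigma> = 1 \<or> \<sigma> = - 1" and act_if:
    "\<And>s. ?w' (circ s) = (if \<sigma> = 1 then id else Bbar_lin ix) (w (circ (\<sigma> * s + b)))"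
    by (rule loop_act_circ[OF g lin vals]) (rule that)
  \<comment> \<open>\<open>K\<close> acts on the cotangent bundle and \<open>J\<close> on phase
    space; \<open>K_iota\<close> says that the Moser embedding intertwines them.\<close>
  define K where "K = (if \<sigma> = 1 then id else Bbar_lin ix)"
  define J where "J = (if \<sigma> = 1 then id else birkhoff ix)"
  have act: "?w' (circ s) = K (w (circ (\<sigma> * s + b)))" for s
    by (simp add: act_if K_def)
  have K_lin: "bounded_linear K"
    by (simp add: K_def bounded_linear_Bbar_lin id_def bounded_linear_ident)
  have K_K: "K (K z) = z" for z
    by (simp add: K_def)
  have K_pole: "fst (K z) = pole \<longleftrightarrow> fst z = pole" for z
    by (simp add: K_def rho_eq_pole_iff)
  have K_iota: "(iota_map \<circ> phi_map ix \<mu>) (J z) = K ((iota_map \<circ> phi_map ix \<mu>) z)" for z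
    using Bbar_iota_phi[of ix \<mu> z] by (simp add: Bbar_eq_lin iota_map_TstarS K_def J_def)
  have J_phase: "J z \<in> phase_space ix \<mu>" if "z \<in> phase_space ix \<mu>" for z
    using that by (simp add: J_def birkhoff_phase_space)
  have "?w' \<in> smooth_loops ?M"
    using Bbar_moser_reg[OF S] by (intro loop_act_smooth_loops[OF _ bounded_linear_Bbar_lin lin g loop]) blast
  moreover have "vector_derivative (\<lambda>r. ?w' (circ r)) (at s) \<noteq> 0" for s
  proof -
    let ?D = "vector_derivative (\<lambda>r. w (circ r)) (at (\<sigma> * s + b))"
    have "k_smooth (Suc 0) (\<lambda>r. w (circ r))"
      using loop by (simp only: smooth_loops_def smooth_curve_iff_k_smooth mem_Collect_eq)
    then have "((\<lambda>r. w (circ r)) has_vector_derivative ?D) (at (\<sigma> * s + b))"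
      unfolding k_smooth.simps by (metis vector_derivative_at)
    from bounded_linear.has_vector_derivative[OF K_lin
        has_vector_derivative_affine[where f = "\<lambda>r. w (circ r)", OF this]]
    have "vector_derivative (\<lambda>r. ?w' (circ r)) (at s) = K (\<sigma> *\<^sub>R ?D)"
      unfolding act by (rule vector_derivative_at)
    \<comment> \<open>A linear involution is injective, and \<sigma> is nonzero.\<close>
    moreover have "K (\<sigma> *\<^sub>R ?D) \<noteq> 0"
    proof
      assume "K (\<sigma> *\<^sub>R ?D) = 0"
      then have "\<sigma> *\<^sub>R ?D = K 0"
        by (metis K_K)
      then show False
        using immersed \<sigma> by (auto simp: linear_0[OF bounded_linear.linear[OF K_lin]])
    qed
    ultimately show ?thesis by simp
  qed
  moreover have "closure {s. fst (?w' (circ s)) \<noteq> pole} = UNIV"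
  proof -
    \<comment> \<open>The inverse of the change of time, as \<sigma> squares to 1. It carries
      noncollision times of \<open>w\<close> to those of \<open>?w'\<close>, and as a continuous
      surjection it preserves density.\<close>
    let ?f = "\<lambda>r. \<sigma> * (r - b)"
    have f: "\<sigma> * ?f r + b = r" "?f (\<sigma> * r + b) = r" for r
      using \<sigma> by auto
    have "?f ` {s. fst (w (circ s)) \<noteq> pole} \<subseteq> {s. fst (?w' (circ s)) \<noteq> pole}"
      by (auto simp: act K_pole f)
    moreover have "?f ` closure {s. fst (w (circ s)) \<noteq> pole} \<subseteq> closure (?f ` {s. fst (w (circ s)) \<noteq> pole})"
      by (rule continuous_image_closure_subset[of UNIV]) (auto intro!: continuous_intros)
    moreover have "range ?f = UNIV"
      using f(2) by (rule surjI)
    ultimately show ?thesis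
      using closure_mono[of "?f ` {s. fst (w (circ s)) \<noteq> pole}" "{s. fst (?w' (circ s)) \<noteq> pole}"] dense
      by auto
  qed
  moreover have "\<exists>z a X. (\<forall>\<^sub>F r in nhds s. (iota_map \<circ> phi_map ix \<mu>) (z r) = ?w' (circ r)) \<and>
      z s \<in> phase_space ix \<mu> \<and> a > 0 \<and> ham_vector ix \<mu> (z s) X \<and>
      (z has_vector_derivative a *\<^sub>R X) (at s)" if "fst (?w' (circ s)) \<noteq> pole" for s
  proof -
    have "fst (w (circ (\<sigma> * s + b))) \<noteq> pole"
      using that by (simp add: act K_pole)
    from traj[OF this] obtain z a X where
      near: "\<forall>\<^sub>F r in nhds (\<sigma> * s + b). (iota_map \<circ> phi_map ix \<mu>) (z r) = w (circ r)"
      and phase: "z (\<sigma> * s + b) \<in> phase_space ix \<mu>" and a: "a > 0"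
      and X: "ham_vector ix \<mu> (z (\<sigma> * s + b)) X"
      and z: "(z has_vector_derivative a *\<^sub>R X) (at (\<sigma> * s + b))"
      by blast
    \<comment> \<open>Continuity pulls the local lift back from a neighbourhood of the shifted time
      to one of \<open>s\<close>.\<close>
    have "((\<lambda>r. \<sigma> * r + b) \<longlongrightarrow> \<sigma> * s + b) (nhds s)"
      by (intro tendsto_intros filterlim_ident)
    from eventually_compose_filterlim[OF near this]
    have "\<forall>\<^sub>F r in nhds s. (iota_map \<circ> phi_map ix \<mu>) (J (z (\<sigma> * r + b))) = ?w' (circ r)"
      by eventually_elim (simp only: K_iota act)
    with ham_vector_affine_time[OF ix \<sigma> X z, folded J_def] J_phase[OF phase] a
    show ?thesis
      by (intro exI[of _ "\<lambda>r. J (z (\<sigma> * r + b))"] exI[of _ a] exI[of _ "\<sigma> *\<^sub>R J X"] conjI)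
  qed
  ultimately show ?thesis
    unfolding regularized_trajectories_def by (intro CollectI conjI allI impI)
qed

theorem mainTheorem1:
  fixes ix :: "nat \<Rightarrow> 'n::finite" and \<mu> :: real
  assumes "CARD('n) \<ge> 2"
    and "bij_betw ix {1..CARD('n)} (UNIV :: 'n set)"
    and "0 \<le> \<mu>" and "\<mu> < 1"
  shows
    "(\<forall>z\<in>phase_space ix \<mu>. birkhoff ix z \<in> phase_space ix \<mu> \<and> Ham ix \<mu> (birkhoff ix z) = Ham ix \<mu> z)
   \<and> antisymplectic_involution TstarS omega_S (Bbar ix)
   \<and> Bbar ix \<circ> iota_map \<circ> phi_map ix \<mu> = iota_map \<circ> phi_map ix \<mu> \<circ> birkhoff ix
   \<and> is_O2_action (smooth_loops TstarS) (loop_act (Bbar ix))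
   \<and> is_O2_action (smooth_loops Sn) (loop_act (rho ix))
   \<and> (\<forall>g\<in>O2. \<forall>w\<in>smooth_loops (TstarS :: 'n covec set).
        fst \<circ> w \<in> smooth_loops Sn \<and>
        (\<forall>t\<in>S1. (fst \<circ> loop_act (Bbar ix) g w) t = loop_act (rho ix) g (fst \<circ> w) t))
   \<and> (\<forall>\<tau>>0. is_O2_action (periodic_trajectories ix \<mu> \<tau>) (loop_act (birkhoff ix)) \<and>
        (\<forall>g\<in>O2. \<forall>v\<in>periodic_trajectories ix \<mu> \<tau>.
           iota_map \<circ> phi_map ix \<mu> \<circ> v \<in> smooth_loops TstarS \<and>
           (\<forall>t\<in>S1. (iota_map \<circ> phi_map ix \<mu> \<circ> loop_act (birkhoff ix) g v) t
                  = loop_act (Bbar ix) g (iota_map \<circ> phi_map ix \<mu> \<circ> v) t)))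
   \<and> (\<forall>c S. S \<subseteq> energy_surface ix \<mu> c \<and> birkhoff ix ` S = S \<longrightarrow>
        Bbar ix ` moser_reg ix \<mu> S = moser_reg ix \<mu> S \<and>
        is_O2_action (regularized_trajectories ix \<mu> S) (loop_act (Bbar ix)))"
proof -
  \<comment> \<open>The dimension bound puts both 1 and 2 in the domain where the numbering is
    injective.\<close>
  have "inj_on ix {1..CARD('n)}" "1 \<in> {1..CARD('n)}" "2 \<in> {1..CARD('n)}"
    using assms(1,2) by (auto simp: bij_betw_def)
  then have ix: "ix 1 \<noteq> ix 2"
    using inj_on_eq_iff by fastforce
  have Bbar_invol: "\<forall>z\<in>TstarS. Bbar ix z \<in> TstarS \<and> Bbar ix (Bbar ix z) = z"
    using antisymplectic_involution_Bbar[of ix] by (simp add: antisymplectic_involution_def)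
  have fst_loop: "fst \<circ> w \<in> smooth_loops Sn" if "w \<in> smooth_loops TstarS" for w :: "real^2 \<Rightarrow> 'n covec"
    using that k_smooth_linear[OF bounded_linear_fst, of _ "\<lambda>s. w (circ s)"]
    by (auto simp: smooth_loops_def smooth_curve_iff_k_smooth TstarS_def)
  have fst_act: "(fst \<circ> loop_act (Bbar ix) g w) t = loop_act (rho ix) g (fst \<circ> w) t"
    if "g \<in> O2" "w \<in> smooth_loops TstarS" "t \<in> S1" for g t and w :: "real^2 \<Rightarrow> 'n covec"
  proof -
    \<comment> \<open>At this point \<open>Bbar\<close> agrees with its linear form, whose base
      component is \<open>rho\<close>.\<close>
    have "w (g *v t) \<in> TstarS"
      using that O2_mult_S1 by (simp add: smooth_loops_def)
    then show ?thesis
      using that(1) by (simp add: loop_act_def eps_O2 Bbar_eq_lin)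
  qed
  have iota_act: "(iota_map \<circ> phi_map ix \<mu> \<circ> loop_act (birkhoff ix) g v) t
      = loop_act (Bbar ix) g (iota_map \<circ> phi_map ix \<mu> \<circ> v) t" if "g \<in> O2" for g v t
    using that by (simp add: loop_act_def eps_O2 Bbar_iota_phi)
  have act_TstarS: "is_O2_action (smooth_loops TstarS) (loop_act (Bbar ix))"
  proof (rule is_O2_actionI[of TstarS])
    show "loop_act (Bbar ix) g w \<in> smooth_loops TstarS"
      if "g \<in> O2" "w \<in> smooth_loops TstarS" for g w
      by (rule loop_act_smooth_loops[OF _ bounded_linear_Bbar_lin[of ix] _ that])
        (use Bbar_invol Bbar_eq_lin in blast)+
  qed (use Bbar_invol in \<open>auto simp: smooth_loops_def\<close>)
  have act_Sn: "is_O2_action (smooth_loops Sn) (loop_act (rho ix))"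
  proof (rule is_O2_actionI[of Sn])
    show "loop_act (rho ix) g w \<in> smooth_loops Sn" if "g \<in> O2" "w \<in> smooth_loops Sn" for g w
      by (rule loop_act_smooth_loops[OF _ bounded_linear_rho[of ix] _ that]) (simp_all add: rho_Sn)
  qed (auto simp: smooth_loops_def)
  have act_periodic: "is_O2_action (periodic_trajectories ix \<mu> \<tau>) (loop_act (birkhoff ix))"
    if "\<tau> > 0" for \<tau>
    by (rule is_O2_actionI[of UNIV]) (use loop_act_periodic_trajectories[OF ix that] in auto)
  have act_regularized: "is_O2_action (regularized_trajectories ix \<mu> S) (loop_act (Bbar ix))"
    if "birkhoff ix ` S = S" for S
  proof (rule is_O2_actionI[of TstarS])
    show "\<forall>w\<in>regularized_trajectories ix \<mu> S. \<forall>t\<in>S1. w t \<in> TstarS"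
      using moser_reg_TstarS[of ix \<mu> S] by (auto simp: regularized_trajectories_def smooth_loops_def)
  qed (use Bbar_invol loop_act_regularized_trajectories[OF ix that] in auto)
  show ?thesis
  proof (intro conjI)
    show "\<forall>z\<in>phase_space ix \<mu>. birkhoff ix z \<in> phase_space ix \<mu> \<and> Ham ix \<mu> (birkhoff ix z) = Ham ix \<mu> z"
      by (simp add: birkhoff_phase_space Ham_birkhoff[OF ix])
    show "Bbar ix \<circ> iota_map \<circ> phi_map ix \<mu> = iota_map \<circ> phi_map ix \<mu> \<circ> birkhoff ix"
      by (simp add: fun_eq_iff Bbar_iota_phi)
    show "\<forall>g\<in>O2. \<forall>w\<in>smooth_loops (TstarS :: 'n covec set).
        fst \<circ> w \<in> smooth_loops Sn \<and>
        (\<forall>t\<in>S1. (fst \<circ> loop_act (Bbar ix) g w) t = loop_act (rho ix) g (fst \<circ> w) t)"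
      by (intro ballI conjI fst_loop fst_act)
    show "\<forall>\<tau>>0. is_O2_action (periodic_trajectories ix \<mu> \<tau>) (loop_act (birkhoff ix)) \<and>
        (\<forall>g\<in>O2. \<forall>v\<in>periodic_trajectories ix \<mu> \<tau>.
           iota_map \<circ> phi_map ix \<mu> \<circ> v \<in> smooth_loops TstarS \<and>
           (\<forall>t\<in>S1. (iota_map \<circ> phi_map ix \<mu> \<circ> loop_act (birkhoff ix) g v) t
                  = loop_act (Bbar ix) g (iota_map \<circ> phi_map ix \<mu> \<circ> v) t))"
    proof (intro allI impI ballI conjI act_periodic iota_act)
      fix \<tau> v assume "v \<in> periodic_trajectories ix \<mu> \<tau>"
      then show "iota_map \<circ> phi_map ix \<mu> \<circ> v \<in> smooth_loops TstarS"
        unfolding periodic_trajectories_def by (blast intro: iota_phi_smooth_loops)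
    qed
    show "\<forall>c S. S \<subseteq> energy_surface ix \<mu> c \<and> birkhoff ix ` S = S \<longrightarrow>
        Bbar ix ` moser_reg ix \<mu> S = moser_reg ix \<mu> S \<and>
        is_O2_action (regularized_trajectories ix \<mu> S) (loop_act (Bbar ix))"
      by (simp add: Bbar_moser_reg act_regularized)
  qed (fact antisymplectic_involution_Bbar act_TstarS act_Sn)+
qed

end
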